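(* Let $G=(V,E)$ be a Bonnet-Myers sharp graph of diameter $2$. Then there exist integers $a>0$ and $b\ge 0$ such that $G$ is isomorphic to $G(a,b)$.
   Context: For non-negative integers $a,b$ with $a>0$, $G(a,b)$ is the graph on vertices $u_1,\ldots,u_{2a},v_1,\ldots,v_b$ in which two distinct vertices are adjacent unless they form a pair $\{u_{2i-1},u_{2i}\}$ for some $1\le i\le a$ (i.e. $K_{2a+b}$ minus a matching of $a$ edges). Graphs are finite, simple, undirected, unweighted and connected; $d(x,y)$ is graph distance, $d_x$ the degree. For $p\in[0,1]$ let $\mu_x^p(z)=p$ if $z=x$, $\frac{1-p}{d_x}$ if $z\sim x$, $0$ otherwise. $W_1(\mu_1,\mu_2)=\inf_\pi\sum_{x,y}d(x,y)\pi(x,y)$ over couplings $\pi$ of $\mu_1,\mu_2$. For an edge $x\sim y$, $\kappa_p(x,y)=1-W_1(\mu_x^p,\mu_y^p)$ and $\kappa_{LLY}(x,y)=\lim_{p\to1}\kappa_p(x,y)/(1-p)$. A graph $G$ is Bonnet-Myers sharp if $\inf_{x\sim y}\kappa_{LLY}(x,y)=2/\operatorname{diam}(G)$. *)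

theory Defs
  imports Complex_Main "Graph_Theory.Graph_Theory"
begin

text \<open>
  A finite simple undirected graph is a \<open>pair_graph\<close>, in which every undirected edge is
  represented by its two opposite arcs. In particular \<open>out_degree\<close> is the vertex degree.
\<close>

definition graph_dist :: "'a pair_pre_digraph \<Rightarrow> 'a \<Rightarrow> 'a \<Rightarrow> nat" where
  "graph_dist G x y = (LEAST n. \<exists>p. pre_digraph.awalk (with_proj G) x p y \<and> length p = n)"

definition graph_diam :: "'a pair_pre_digraph \<Rightarrow> nat" where
  "graph_diam G = Max {graph_dist G x y | x y. x \<in> pverts G \<and> y \<in> pverts G}"

definition lazy_measure :: "'a pair_pre_digraph \<Rightarrow> real \<Rightarrow> 'a \<Rightarrow> 'a \<Rightarrow> real" where
  "lazy_measure G p x z =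
     (if z = x then p
      else if (x, z) \<in> parcs G then (1 - p) / real (out_degree (with_proj G) x)
      else 0)"

definition couplings ::
    "'a pair_pre_digraph \<Rightarrow> ('a \<Rightarrow> real) \<Rightarrow> ('a \<Rightarrow> real) \<Rightarrow> ('a \<Rightarrow> 'a \<Rightarrow> real) set" where
  "couplings G \<mu>1 \<mu>2 =
     {\<pi>. (\<forall>x\<in>pverts G. \<forall>y\<in>pverts G. 0 \<le> \<pi> x y) \<and>
         (\<forall>x\<in>pverts G. (\<Sum>y\<in>pverts G. \<pi> x y) = \<mu>1 x) \<and>
         (\<forall>y\<in>pverts G. (\<Sum>x\<in>pverts G. \<pi> x y) = \<mu>2 y)}"

definition wasserstein1 :: "'a pair_pre_digraph \<Rightarrow> ('a \<Rightarrow> real) \<Rightarrow> ('a \<Rightarrow> real) \<Rightarrow> real" where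
  "wasserstein1 G \<mu>1 \<mu>2 =
     (INF \<pi>\<in>couplings G \<mu>1 \<mu>2.
        \<Sum>x\<in>pverts G. \<Sum>y\<in>pverts G. real (graph_dist G x y) * \<pi> x y)"

definition ollivier_curvature :: "'a pair_pre_digraph \<Rightarrow> real \<Rightarrow> 'a \<Rightarrow> 'a \<Rightarrow> real" where
  "ollivier_curvature G p x y =
     1 - wasserstein1 G (lazy_measure G p x) (lazy_measure G p y)"

text \<open>The idleness \<open>p\<close> lies in \<open>[0, 1]\<close>, so the limit is taken from the left.\<close>

definition lly_curvature :: "'a pair_pre_digraph \<Rightarrow> 'a \<Rightarrow> 'a \<Rightarrow> real" where
  "lly_curvature G x y = Lim (at_left 1) (\<lambda>p. ollivier_curvature G p x y / (1 - p))"

definition bonnet_myers_sharp :: "'a pair_pre_digraph \<Rightarrow> bool" where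
  "bonnet_myers_sharp G \<longleftrightarrow>
     (INF (x, y)\<in>parcs G. lly_curvature G x y) = 2 / real (graph_diam G)"

text \<open>The graph \<open>G(a, b)\<close>: \<open>Inl i\<close> is the vertex \<open>u\<^sub>i\<close> and \<open>Inr j\<close> is the vertex \<open>v\<^sub>j\<close>.\<close>

definition matching_complement_verts :: "nat \<Rightarrow> nat \<Rightarrow> (nat + nat) set" where
  "matching_complement_verts a b = Inl ` {1..2 * a} \<union> Inr ` {1..b}"

definition matching_complement_graph :: "nat \<Rightarrow> nat \<Rightarrow> (nat + nat) pair_pre_digraph" where
  "matching_complement_graph a b =
     \<lparr> pverts = matching_complement_verts a b,
       parcs = {(x, y). x \<in> matching_complement_verts a b \<and> y \<in> matching_complement_verts a b \<and> x \<noteq> y \<and>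
                  \<not> (\<exists>i\<in>{1..a}. {x, y} = {Inl (2 * i - 1), Inl (2 * i)})} \<rparr>"

lemma pair_graph_matching_complement_graph: "pair_graph (matching_complement_graph a b)"
proof
  show "finite (pverts (matching_complement_graph a b))"
    by (simp add: matching_complement_graph_def matching_complement_verts_def)
  have "parcs (matching_complement_graph a b) \<subseteq> matching_complement_verts a b \<times> matching_complement_verts a b"
    by (auto simp: matching_complement_graph_def)
  then show "finite (parcs (matching_complement_graph a b))"
    by (rule finite_subset) (simp add: matching_complement_verts_def)
  show "symmetric (with_proj (matching_complement_graph a b))"
    unfolding symmetric_def
    by (rule symI) (auto simp: matching_complement_graph_def insert_commute)
qed (auto simp: matching_complement_graph_def)

context pair_graph
begin

text \<open>\<open>graph_dist\<close> is the library's shortest-path cost \<open>\<mu>\<close> for unit arc weights.\<close>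

lemma graph_dist_eq_\<mu>:
  assumes "x \<rightarrow>\<^sup>*\<^bsub>with_proj G\<^esub> y"
  shows "ereal (real (graph_dist G x y)) = \<mu> (\<lambda>_. 1) x y"
proof -
  have cost: "awalk_cost (\<lambda>_. 1) p = real (length p)" for p :: "('a \<times> 'a) list"
    by (induction p) auto
  from assms obtain q where "awalk x q y" by (auto simp: reachable_awalk)
  then have "\<exists>n p. awalk x p y \<and> length p = n" by blast
  then have "\<exists>p. awalk x p y \<and> length p = graph_dist G x y"
    unfolding graph_dist_def by (rule LeastI_ex)
  then obtain p where p: "awalk x p y" "length p = graph_dist G x y" by blast
  have le: "graph_dist G x y \<le> length q" if "awalk x q y" for q
    unfolding graph_dist_def by (rule Least_le) (use that in blast)
  show ?thesis
    unfolding \<mu>_def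
  proof (rule antisym)
    show "ereal (real (graph_dist G x y)) \<le> (INF p\<in>{p. awalk x p y}. ereal (awalk_cost (\<lambda>_. 1) p))"
      by (rule INF_greatest) (simp add: cost le)
    show "(INF p\<in>{p. awalk x p y}. ereal (awalk_cost (\<lambda>_. 1) p)) \<le> ereal (real (graph_dist G x y))"
      by (rule INF_lower2[of p]) (use p cost in auto)
  qed
qed

text \<open>
  On an edge, the infimum defining \<open>wasserstein1\<close> is over a nonempty set of costs bounded
  below by \<open>0\<close>.
\<close>

lemma sum_lazy_measure:
  assumes "(x, y) \<in> parcs G"
  shows "(\<Sum>z\<in>pverts G. lazy_measure G p x z) = 1"
proof -
  define N where "N = {z. (x, z) \<in> parcs G}"
  have x: "x \<in> pverts G" using assms arc_fst_in_verts by force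
  have sub: "N \<subseteq> pverts G - {x}"
    using arc_snd_in_verts pair_no_loops by (force simp: N_def)
  have fin: "finite N" using sub pair_finite_verts by (meson finite_Diff finite_subset)
  have "out_arcs (with_proj G) x = Pair x ` N"
    by (auto simp: out_arcs_def N_def)
  then have deg: "out_degree (with_proj G) x = card N"
    by (simp add: out_degree_def card_image inj_on_def)
  have "card N \<noteq> 0" using fin assms by (auto simp: N_def)
  have "(\<Sum>z\<in>pverts G. lazy_measure G p x z) = p + (\<Sum>z\<in>pverts G - {x}. lazy_measure G p x z)"
    using x pair_finite_verts by (simp add: sum.remove lazy_measure_def)
  also have "(\<Sum>z\<in>pverts G - {x}. lazy_measure G p x z) = (\<Sum>z\<in>N. (1 - p) / real (card N))"
    by (rule sum.mono_neutral_cong_right)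
       (use sub pair_finite_verts deg in \<open>auto simp: lazy_measure_def N_def\<close>)
  also have "p + \<dots> = 1" using \<open>card N \<noteq> 0\<close> by simp
  finally show ?thesis .
qed

lemma couplings_lazy_measure_nonempty:
  assumes "(x, y) \<in> parcs G" "0 \<le> p" "p \<le> 1"
  shows "couplings G (lazy_measure G p x) (lazy_measure G p y) \<noteq> {}"
proof -
  have yx: "(y, x) \<in> parcs G" using assms(1) pair_sym_arcs
    by (auto simp: symmetric_def dest: symD)
  have "(\<lambda>u v. lazy_measure G p x u * lazy_measure G p y v)
      \<in> couplings G (lazy_measure G p x) (lazy_measure G p y)"
    using sum_lazy_measure[OF assms(1)] sum_lazy_measure[OF yx] assms(2,3)
    by (auto simp: couplings_def simp flip: sum_distrib_left sum_distrib_right)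
       (auto simp: lazy_measure_def)
  then show ?thesis by blast
qed

lemma bdd_below_transport_costs:
  "bdd_below ((\<lambda>\<pi>. \<Sum>x\<in>pverts G. \<Sum>y\<in>pverts G. real (graph_dist G x y) * \<pi> x y)
     ` couplings G \<mu>1 \<mu>2)"
  by (rule bdd_belowI[of _ 0]) (auto simp: couplings_def intro!: sum_nonneg)

end

end

theory Submission
  imports Defs
begin

text \<open>
  Sharpness in diameter \<open>2\<close> gives every edge curvature at least \<open>1\<close>. Kantorovich duality with the
  potential \<open>d(z, \<cdot>)\<close> turns this into: along an edge \<open>x \<sim> y\<close> with \<open>d(z, x) = d(z, y) + 1\<close>, the mean
  of \<open>d(z, \<cdot>)\<close> over the neighbours of \<open>x\<close> is at most its mean over the neighbours of \<open>y\<close>. Taking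
  \<open>z = y\<close>, at most one neighbour of \<open>x\<close> lies outside the closed neighbourhood of \<open>y\<close>. If there is
  such a neighbour \<open>w\<close> of \<open>x\<close>, and symmetrically \<open>z\<close> of \<open>y\<close>, then the degrees agree, and the same
  inequality for this \<open>z\<close> forces \<open>w \<sim> z\<close>. These two facts rule out a vertex with two
  non-neighbours, so the complement of the graph is a matching.
\<close>

section \<open>Monotone limits, Kantorovich duality and digraph isomorphisms\<close>

text \<open>The limit is the supremum over \<open>{a..<b}\<close>. This makes the limit in
  \<open>lly_curvature\<close> exist and passes a bound on the quotients at all idlenesses on to
  it.\<close>

lemma bounded_mono_tendsto_at_left:
  fixes g :: "real \<Rightarrow> real"
  assumes "a < b"
    and mono: "\<And>p q. a \<le> p \<Longrightarrow> p \<le> q \<Longrightarrow> q < b \<Longrightarrow> g p \<le> g q"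
    and bound: "\<And>p. a \<le> p \<Longrightarrow> p < b \<Longrightarrow> g p \<le> C"
  obtains l where "(g \<longlongrightarrow> l) (at_left b)" "l \<le> C"
proof
  let ?l = "SUP p\<in>{a..<b}. g p"
  have ne: "{a..<b} \<noteq> {}" using \<open>a < b\<close> by simp
  have bdd: "bdd_above (g ` {a..<b})"
    by (rule bdd_aboveI2[where M = C]) (use bound in auto)
  show "?l \<le> C" by (rule cSUP_least[OF ne]) (use bound in auto)
  have near: "eventually (\<lambda>q. p \<le> q \<and> q < b) (at_left b)" if "p < b" for p
    unfolding eventually_at_left_field using that by (intro exI[of _ p]) auto
  show "(g \<longlongrightarrow> ?l) (at_left b)"
  proof (rule order_tendstoI)
    fix c assume "c < ?l"
    then obtain p where p: "p \<in> {a..<b}" "c < g p"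
      using less_cSUP_iff[OF ne bdd] by blast
    then have "p < b" by simp
    show "eventually (\<lambda>q. c < g q) (at_left b)"
      by (rule eventually_mono[OF near[OF \<open>p < b\<close>]]) (use p mono in fastforce)
  next
    fix c assume c: "?l < c"
    show "eventually (\<lambda>q. g q < c) (at_left b)"
    proof (rule eventually_mono[OF near[OF \<open>a < b\<close>]])
      fix q assume "a \<le> q \<and> q < b"
      then have "g q \<le> ?l" by (intro cSUP_upper[OF _ bdd]) auto
      with c show "g q < c" by simp
    qed
  qed
qed

text \<open>The easy half of Kantorovich duality: by the marginal conditions the left side is the
  sum of \<open>f u - f v\<close> against any coupling, and the Lipschitz condition bounds this by
  its cost. A coupling must exist because \<open>INF\<close> over an empty set of reals carries no
  information.\<close>

lemma wasserstein1_ge_dual: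
  assumes "couplings G \<mu>1 \<mu>2 \<noteq> {}"
    and lip: "\<And>u v. u \<in> pverts G \<Longrightarrow> v \<in> pverts G \<Longrightarrow> f u - f v \<le> real (graph_dist G u v)"
  shows "(\<Sum>u\<in>pverts G. \<mu>1 u * f u) - (\<Sum>v\<in>pverts G. \<mu>2 v * f v) \<le> wasserstein1 G \<mu>1 \<mu>2"
  unfolding wasserstein1_def
proof (rule cINF_greatest[OF assms(1)])
  let ?V = "pverts G"
  fix \<pi> assume \<pi>: "\<pi> \<in> couplings G \<mu>1 \<mu>2"
  have "(\<Sum>u\<in>?V. \<mu>1 u * f u) = (\<Sum>u\<in>?V. \<Sum>v\<in>?V. f u * \<pi> u v)"
    using \<pi> by (intro sum.cong) (auto simp: couplings_def simp flip: sum_distrib_left)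
  moreover have "(\<Sum>v\<in>?V. \<mu>2 v * f v) = (\<Sum>v\<in>?V. \<Sum>u\<in>?V. f v * \<pi> u v)"
    using \<pi> by (intro sum.cong) (auto simp: couplings_def simp flip: sum_distrib_left)
  moreover have "(\<Sum>v\<in>?V. \<Sum>u\<in>?V. f v * \<pi> u v) = (\<Sum>u\<in>?V. \<Sum>v\<in>?V. f v * \<pi> u v)"
    by (rule sum.swap)
  ultimately have "(\<Sum>u\<in>?V. \<mu>1 u * f u) - (\<Sum>v\<in>?V. \<mu>2 v * f v)
      = (\<Sum>u\<in>?V. \<Sum>v\<in>?V. (f u - f v) * \<pi> u v)"
    by (simp add: sum_subtractf left_diff_distrib)
  also have "\<dots> \<le> (\<Sum>u\<in>?V. \<Sum>v\<in>?V. real (graph_dist G u v) * \<pi> u v)"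
    using \<pi> lip by (intro sum_mono mult_right_mono) (auto simp: couplings_def)
  finally show "(\<Sum>u\<in>?V. \<mu>1 u * f u) - (\<Sum>v\<in>?V. \<mu>2 v * f v)
      \<le> (\<Sum>u\<in>?V. \<Sum>v\<in>?V. real (graph_dist G u v) * \<pi> u v)" .
qed

text \<open>The bijection runs from \<open>H\<close> to \<open>G\<close> because it will be an
  enumeration of the vertices of \<open>G\<close> by those of the model graph; its inverse supplies
  the isomorphism.\<close>

lemma digraph_iso_with_projI:
  assumes "pair_wf_digraph G"
    and bij: "bij_betw g (pverts H) (pverts G)"
    and "pair_wf_digraph H"
    and adj: "\<And>x y. x \<in> pverts H \<Longrightarrow> y \<in> pverts H \<Longrightarrow> (g x, g y) \<in> parcs G \<longleftrightarrow> (x, y) \<in> parcs H"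
  shows "digraph_iso (with_proj G) (with_proj H)"
proof -
  interpret G: pair_wf_digraph G by fact
  interpret H: pair_wf_digraph H by fact
  define h where "h = the_inv_into (pverts H) g"
  have h: "bij_betw h (pverts G) (pverts H)"
    unfolding h_def by (rule bij_betw_the_inv_into[OF bij])
  have gh: "g (h u) = u" if "u \<in> pverts G" for u
    using that bij by (auto simp: h_def bij_betw_def f_the_inv_into_f)
  have hg: "h (g x) = x" if "x \<in> pverts H" for x
    using that bij by (auto simp: h_def bij_betw_def the_inv_into_f_f)
  have hV: "h u \<in> pverts H" if "u \<in> pverts G" for u
    using that h by (auto simp: bij_betw_def)
  have gV: "g u \<in> pverts G" if "u \<in> pverts H" for u
    using that bij by (auto simp: bij_betw_def)
  have arcs: "map_prod h h ` parcs G = parcs H"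
  proof (intro equalityI subsetI)
    fix e assume "e \<in> map_prod h h ` parcs G"
    then obtain u v where "(u, v) \<in> parcs G" "e = (h u, h v)" by auto
    moreover from this have "u \<in> pverts G" "v \<in> pverts G"
      by (auto dest: G.in_arcsD1 G.in_arcsD2)
    ultimately show "e \<in> parcs H" using adj[of "h u" "h v"] gh hV by simp
  next
    fix e assume e: "e \<in> parcs H"
    obtain x y where xy: "e = (x, y)" by fastforce
    then have V: "x \<in> pverts H" "y \<in> pverts H"
      using e by (auto dest: H.in_arcsD1 H.in_arcsD2)
    then have "(g x, g y) \<in> parcs G" using adj e xy by simp
    moreover have "e = map_prod h h (g x, g y)" using V hg xy by simp
    ultimately show "e \<in> map_prod h h ` parcs G" by blast
  qed
  let ?iso = "\<lparr>iso_verts = h, iso_arcs = map_prod h h, iso_head = snd, iso_tail = fst\<rparr>"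
  have "inj_on (map_prod h h) (parcs G)"
  proof (rule inj_on_subset)
    show "inj_on (map_prod h h) (pverts G \<times> pverts G)"
      using h by (intro map_prod_inj_on) (auto simp: bij_betw_def)
    show "parcs G \<subseteq> pverts G \<times> pverts G"
      by (auto dest: G.in_arcsD1 G.in_arcsD2)
  qed
  then have "pre_digraph.digraph_isomorphism (with_proj G) ?iso"
    using h assms(1) by (auto simp: pre_digraph.digraph_isomorphism_def bij_betw_def wf_digraph_wp_iff)
  moreover have "with_proj H = app_iso ?iso (with_proj G)"
    using h arcs by (simp add: app_iso_def with_proj_def bij_betw_def)
  ultimately show ?thesis unfolding digraph_iso_def by blast
qed

section \<open>Neighbourhoods, lazy measures and curvature bounds on an edge\<close>

context pair_graph
begin

abbreviation nbrs :: "'a \<Rightarrow> 'a set" where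
  "nbrs x \<equiv> parcs G `` {x}"

lemma adj_sym: "(x, y) \<in> parcs G \<longleftrightarrow> (y, x) \<in> parcs G"
  using pair_sym_arcs by (auto simp: symmetric_def dest: symD)

lemma not_adj_self [simp]: "(x, x) \<notin> parcs G"
  using pair_no_loops by fastforce

lemma finite_nbrs [simp]: "finite (nbrs x)"
  using pair_finite_arcs by (rule finite_Image)

lemma nbrs_subset: "nbrs x \<subseteq> pverts G"
  by (auto dest: in_arcsD2)

lemma out_degree_eq_card_nbrs: "out_degree (with_proj G) x = card (nbrs x)"
proof -
  have "out_arcs (with_proj G) x = Pair x ` nbrs x"
    by (auto simp: out_arcs_def)
  then show ?thesis by (simp add: out_degree_def card_image inj_on_def)
qed

lemma sum_lazy_measure_mult:
  assumes "x \<in> pverts G"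
  shows "(\<Sum>z\<in>pverts G. lazy_measure G p x z * f z)
    = p * f x + (1 - p) * ((\<Sum>z\<in>nbrs x. f z) / real (card (nbrs x)))"
proof -
  have "(\<Sum>z\<in>pverts G. lazy_measure G p x z * f z)
      = p * f x + (\<Sum>z\<in>pverts G - {x}. lazy_measure G p x z * f z)"
    using assms pair_finite_verts by (simp add: sum.remove lazy_measure_def)
  also have "(\<Sum>z\<in>pverts G - {x}. lazy_measure G p x z * f z)
      = (\<Sum>z\<in>nbrs x. (1 - p) / real (card (nbrs x)) * f z)"
    by (rule sum.mono_neutral_cong_right)
       (use pair_finite_verts nbrs_subset in
         \<open>auto simp: lazy_measure_def out_degree_eq_card_nbrs\<close>)
  also have "\<dots> = (1 - p) * ((\<Sum>z\<in>nbrs x. f z) / real (card (nbrs x)))"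
    by (simp add: sum_distrib_left sum_divide_distrib)
  finally show ?thesis .
qed

lemma graph_dist_le: "awalk x p y \<Longrightarrow> graph_dist G x y \<le> length p"
  unfolding graph_dist_def by (rule Least_le) blast

lemma graph_dist_adj:
  assumes "(x, y) \<in> parcs G"
  shows "graph_dist G x y \<le> 1"
proof -
  have "awalk x [(x, y)] y"
    using assms by (auto simp: awalk_simps dest: in_arcsD2)
  from graph_dist_le[OF this] show ?thesis by simp
qed

text \<open>
  Mixing a coupling at idleness \<open>p\<close> with the unit mass at \<open>(x, y)\<close> yields a coupling at
  any idleness \<open>q \<ge> p\<close>.
\<close>

lemma wasserstein1_lazy_measure_le:
  assumes xy: "(x, y) \<in> parcs G" and pq: "0 \<le> p" "p \<le> q" "q < 1"
  shows "wasserstein1 G (lazy_measure G q x) (lazy_measure G q y)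
    \<le> (1 - q) / (1 - p) * wasserstein1 G (lazy_measure G p x) (lazy_measure G p y)
        + (1 - (1 - q) / (1 - p))"
proof -
  \<comment> \<open>With \<open>1 - q = t * (1 - p)\<close>, the measure at idleness
    \<open>q\<close> is the one at idleness \<open>p\<close> with weight \<open>t\<close> plus a
    unit mass at the base vertex with weight \<open>1 - t\<close>.\<close>
  define t where "t = (1 - q) / (1 - p)"
  have t: "0 < t" "t \<le> 1" using pq by (auto simp: t_def)
  have tp: "t * (1 - p) = 1 - q" using pq by (simp add: t_def)
  let ?V = "pverts G"
  let ?W = "\<lambda>r. wasserstein1 G (lazy_measure G r x) (lazy_measure G r y)"
  let ?cost = "\<lambda>\<pi>. \<Sum>u\<in>?V. \<Sum>v\<in>?V. real (graph_dist G u v) * \<pi> u v"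
  have V: "x \<in> ?V" "y \<in> ?V" using xy by (auto dest: in_arcsD1 in_arcsD2)
  note fin = pair_finite_verts
  have mix: "lazy_measure G q w u = t * lazy_measure G p w u + (1 - t) * (if u = w then 1 else 0)"
    for w u
  proof -
    have "q = t * p + (1 - t)" using tp by (simp add: algebra_simps)
    then show ?thesis using tp by (simp add: lazy_measure_def)
  qed
  \<comment> \<open>Solving for \<open>?W p\<close> isolates the infimum, so it suffices to bound
    the cost of each single coupling \<open>\<pi>\<close>.\<close>
  have "(?W q - (1 - t)) / t \<le> ?W p"
    unfolding wasserstein1_def[of G "lazy_measure G p x"]
  proof (rule cINF_greatest)
    show "couplings G (lazy_measure G p x) (lazy_measure G p y) \<noteq> {}"
      using couplings_lazy_measure_nonempty xy pq by simp
  next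
    fix \<pi> assume \<pi>: "\<pi> \<in> couplings G (lazy_measure G p x) (lazy_measure G p y)"
    define \<delta> :: "'a \<Rightarrow> 'a \<Rightarrow> real" where "\<delta> u v = (if u = x then if v = y then 1 else 0 else 0)" for u v
    define \<rho> where "\<rho> u v = t * \<pi> u v + (1 - t) * \<delta> u v" for u v
    have "(\<Sum>v\<in>?V. \<delta> u v) = (if u = x then 1 else 0)" for u
      using fin V by (simp add: \<delta>_def)
    moreover have "(\<Sum>u\<in>?V. \<delta> u v) = (if v = y then 1 else 0)" for v
      using fin V by (simp add: \<delta>_def)
    ultimately have "\<rho> \<in> couplings G (lazy_measure G q x) (lazy_measure G q y)"
      using \<pi> t by (auto simp: couplings_def \<rho>_def sum.distrib mix simp flip: sum_distrib_left)
        (auto simp: \<delta>_def)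
    then have "?W q \<le> ?cost \<rho>"
      unfolding wasserstein1_def by (rule cINF_lower[OF bdd_below_transport_costs])
    also have "?cost \<rho> = t * ?cost \<pi> + (1 - t) * ?cost \<delta>"
      by (simp add: \<rho>_def sum_distrib_left flip: sum.distrib) (simp add: algebra_simps)
    also have "?cost \<delta> = real (graph_dist G x y)"
    proof -
      have "?cost \<delta> = (\<Sum>u\<in>?V. \<Sum>v\<in>?V. if v = y then if u = x then real (graph_dist G x y) else 0 else 0)"
        by (intro sum.cong) (auto simp: \<delta>_def)
      then show ?thesis using fin V by simp
    qed
    also have "t * ?cost \<pi> + (1 - t) * real (graph_dist G x y) \<le> t * ?cost \<pi> + (1 - t) * 1"
      using graph_dist_adj[OF xy] t by (intro add_left_mono mult_left_mono) auto
    finally show "(?W q - (1 - t)) / t \<le> ?cost \<pi>"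
      using t by (simp add: field_simps)
  qed
  then show ?thesis using t by (simp add: field_simps flip: t_def)
qed

text \<open>Duality bounds \<open>ollivier_curvature G p x y\<close> for each \<open>p\<close>.
  Since \<open>f\<close> drops by exactly 1 along the edge, the idle masses contribute
  \<open>p\<close>, and a factor \<open>1 - p\<close> splits off: the quotient is at most
  \<open>?C\<close> whatever \<open>p\<close> is.\<close>

lemma lly_curvature_le:
  assumes xy: "(x, y) \<in> parcs G"
    and lip: "\<And>u v. u \<in> pverts G \<Longrightarrow> v \<in> pverts G \<Longrightarrow> f u - f v \<le> real (graph_dist G u v)"
    and grad: "f x - f y = 1"
  shows "lly_curvature G x y
    \<le> 1 + (\<Sum>z\<in>nbrs y. f z) / real (card (nbrs y)) - (\<Sum>z\<in>nbrs x. f z) / real (card (nbrs x))"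
    (is "_ \<le> ?C")
proof -
  have V: "x \<in> pverts G" "y \<in> pverts G" using xy by (auto dest: in_arcsD1 in_arcsD2)
  \<comment> \<open>\<open>Lim\<close> is a definite description, so convergence has to be proved
    before the bound says anything about \<open>lly_curvature\<close>.\<close>
  obtain l where "((\<lambda>p. ollivier_curvature G p x y / (1 - p)) \<longlongrightarrow> l) (at_left 1)" "l \<le> ?C"
  proof (rule bounded_mono_tendsto_at_left)
    show "(0::real) < 1" by simp
  next
    fix p q :: real assume pq: "0 \<le> p" "p \<le> q" "q < 1"
    \<comment> \<open>The mixing bound in terms of \<open>1 - W\<close>: dividing by
      \<open>1 - q\<close> shows that the quotient increases with the idleness.\<close>
    have "(1 - q) / (1 - p) * ollivier_curvature G p x y \<le> ollivier_curvature G q x y"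
      using wasserstein1_lazy_measure_le[OF xy pq]
      by (simp add: ollivier_curvature_def right_diff_distrib)
    then show "ollivier_curvature G p x y / (1 - p) \<le> ollivier_curvature G q x y / (1 - q)"
      using pq by (simp add: pos_le_divide_eq mult.commute)
  next
    fix p :: real assume p: "0 \<le> p" "p < 1"
    let ?A = "(\<Sum>z\<in>nbrs x. f z) / real (card (nbrs x))"
    let ?B = "(\<Sum>z\<in>nbrs y. f z) / real (card (nbrs y))"
    have dual: "p * f x + (1 - p) * ?A - (p * f y + (1 - p) * ?B)
        \<le> wasserstein1 G (lazy_measure G p x) (lazy_measure G p y)"
      using wasserstein1_ge_dual[OF couplings_lazy_measure_nonempty[OF xy p(1)] lip] p
      by (simp add: sum_lazy_measure_mult V)
    have eq: "p * f x + (1 - p) * ?A - (p * f y + (1 - p) * ?B)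
        = p * (f x - f y) + (1 - p) * (?A - ?B)"
      by (simp add: algebra_simps)
    have "ollivier_curvature G p x y \<le> 1 - p - (1 - p) * (?A - ?B)"
      using dual unfolding eq grad ollivier_curvature_def mult_1_right
      by (simp only: diff_diff_eq diff_left_mono)
    also have "\<dots> = (1 - p) * ?C" by (simp add: algebra_simps)
    finally show "ollivier_curvature G p x y / (1 - p) \<le> ?C"
      using p by (simp add: pos_divide_le_eq mult.commute)
  qed
  moreover from this(1) have "lly_curvature G x y = l"
    unfolding lly_curvature_def by (intro tendsto_Lim) simp_all
  ultimately show ?thesis by simp
qed

section \<open>Distances and the diameter\<close>

text \<open>\<open>graph_dist\<close> is a \<open>LEAST\<close>, meaningful only if some walk
  exists; symmetry of the arcs turns connectedness into strong connectedness, which provides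
  one.\<close>

lemma graph_dist_attained:
  assumes "Digraph_Component.connected (with_proj G)" "x \<in> pverts G" "y \<in> pverts G"
  obtains p where "awalk x p y" "length p = graph_dist G x y"
proof -
  have "strongly_connected (with_proj G)"
    using symmetric_connected_imp_strongly_connected assms(1) pair_sym_arcs by blast
  then have "x \<rightarrow>\<^sup>*\<^bsub>with_proj G\<^esub> y"
    using assms(2,3) by (auto simp: strongly_connected_def)
  then obtain q where "awalk x q y" by (auto simp: reachable_awalk)
  then have "\<exists>n p. awalk x p y \<and> length p = n" by blast
  then have "\<exists>p. awalk x p y \<and> length p = graph_dist G x y"
    unfolding graph_dist_def by (rule LeastI_ex)
  then show thesis using that by blast
qed

lemma graph_dist_eq_0_iff:
  assumes "Digraph_Component.connected (with_proj G)" "x \<in> pverts G" "y \<in> pverts G"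
  shows "graph_dist G x y = 0 \<longleftrightarrow> x = y"
proof
  assume "graph_dist G x y = 0"
  then show "x = y" using graph_dist_attained[OF assms] by (metis awalk_Nil_iff length_0_conv)
next
  assume "x = y"
  then show "graph_dist G x y = 0" using graph_dist_le[of x "[]" y] assms by (simp add: awalk_Nil_iff)
qed

lemma graph_dist_eq_1_iff:
  assumes "Digraph_Component.connected (with_proj G)" "x \<in> pverts G" "y \<in> pverts G"
  shows "graph_dist G x y = 1 \<longleftrightarrow> (x, y) \<in> parcs G"
proof
  assume "graph_dist G x y = 1"
  then obtain p where "awalk x p y" "length p = 1"
    using graph_dist_attained[OF assms] by metis
  then show "(x, y) \<in> parcs G" by (auto simp: length_Suc_conv awalk_simps)
next
  assume xy: "(x, y) \<in> parcs G"
  then have "graph_dist G x y \<noteq> 0" using graph_dist_eq_0_iff[OF assms] by auto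
  then show "graph_dist G x y = 1" using graph_dist_adj[OF xy] by simp
qed

lemma graph_dist_eq_2D:
  assumes "Digraph_Component.connected (with_proj G)" "x \<in> pverts G" "y \<in> pverts G"
    and "graph_dist G x y = 2"
  obtains z where "(x, z) \<in> parcs G" "(z, y) \<in> parcs G"
proof -
  obtain p where "awalk x p y" "length p = Suc (Suc 0)"
    using graph_dist_attained[OF assms(1-3)] assms(4) by (metis numeral_2_eq_2)
  then show thesis using that by (auto simp: length_Suc_conv awalk_simps)
qed

lemma finite_graph_dists: "finite {graph_dist G x y | x y. x \<in> pverts G \<and> y \<in> pverts G}"
proof -
  have "{graph_dist G x y | x y. x \<in> pverts G \<and> y \<in> pverts G}
      = (\<lambda>(x, y). graph_dist G x y) ` (pverts G \<times> pverts G)" by auto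
  then show ?thesis using pair_finite_verts by simp
qed

lemma graph_dist_le_graph_diam:
  "x \<in> pverts G \<Longrightarrow> y \<in> pverts G \<Longrightarrow> graph_dist G x y \<le> graph_diam G"
  unfolding graph_diam_def by (rule Max_ge[OF finite_graph_dists]) auto

lemma graph_diam_attained:
  assumes "pverts G \<noteq> {}"
  obtains x y where "x \<in> pverts G" "y \<in> pverts G" "graph_dist G x y = graph_diam G"
  using Max_in[OF finite_graph_dists] assms unfolding graph_diam_def by fastforce

lemma finite_lly_curvature_edges: "finite ((\<lambda>(x, y). lly_curvature G x y) ` parcs G)"
  using pair_finite_arcs by simp

end

section \<open>Local structure of sharp graphs of diameter 2\<close>

locale diam2_sharp_graph = pair_graph +
  assumes conn: "Digraph_Component.connected (with_proj G)"
    and sharp: "bonnet_myers_sharp G"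
    and diam: "graph_diam G = 2"
begin

lemma lly_curvature_ge_1:
  assumes "(x, y) \<in> parcs G"
  shows "1 \<le> lly_curvature G x y"
proof -
  have "(INF (x, y)\<in>parcs G. lly_curvature G x y) \<le> (\<lambda>(x, y). lly_curvature G x y) (x, y)"
    by (rule cINF_lower[OF _ assms]) (simp add: finite_lly_curvature_edges bdd_below_finite)
  then show ?thesis using sharp diam by (simp add: bonnet_myers_sharp_def)
qed

lemma graph_dist_eq:
  assumes "x \<in> pverts G" "y \<in> pverts G"
  shows "graph_dist G x y = (if x = y then 0 else if (x, y) \<in> parcs G then 1 else 2)"
proof -
  have "graph_dist G x y \<le> 2" using graph_dist_le_graph_diam[OF assms] diam by simp
  then show ?thesis
    using graph_dist_eq_0_iff[OF conn assms] graph_dist_eq_1_iff[OF conn assms] by auto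
qed

lemma common_nbr:
  assumes "x \<in> pverts G" "y \<in> pverts G" "x \<noteq> y" "(x, y) \<notin> parcs G"
  obtains z where "(x, z) \<in> parcs G" "(z, y) \<in> parcs G"
  using graph_dist_eq_2D[OF conn assms(1,2)] graph_dist_eq[OF assms(1,2)] assms(3,4) by auto

lemma graph_dist_lipschitz:
  assumes "z \<in> pverts G" "u \<in> pverts G" "v \<in> pverts G"
  shows "real (graph_dist G z u) - real (graph_dist G z v) \<le> real (graph_dist G u v)"
  using assms adj_sym by (auto simp: graph_dist_eq)

text \<open>The potential \<open>d(z, \<cdot>)\<close> has gradient 1 on this edge, so the curvature
  is at most 1 plus the right side minus the left side, while sharpness makes it at least 1.\<close>

lemma avg_graph_dist_le:
  assumes xy: "(x, y) \<in> parcs G" and z: "z \<in> pverts G"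
    and "graph_dist G z x = graph_dist G z y + 1"
  shows "(\<Sum>v\<in>nbrs x. real (graph_dist G z v)) / real (card (nbrs x))
    \<le> (\<Sum>v\<in>nbrs y. real (graph_dist G z v)) / real (card (nbrs y))"
  using lly_curvature_le[OF xy graph_dist_lipschitz[OF z]] lly_curvature_ge_1[OF xy] assms(3)
  by simp

text \<open>For the potential \<open>d(y, \<cdot>)\<close> the mean over \<open>nbrs y\<close> is 1.
  Over \<open>nbrs x\<close>, the vertex \<open>y\<close> contributes 0 and every vertex counted
  here contributes 2, so two of them would push the mean above 1.\<close>

lemma nonnbrs_along_edge_unique:
  assumes xy: "(x, y) \<in> parcs G"
    and w: "w1 \<in> nbrs x - nbrs y - {y}" "w2 \<in> nbrs x - nbrs y - {y}"
  shows "w1 = w2"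
proof (rule ccontr)
  assume "w1 \<noteq> w2"
  have V: "x \<in> pverts G" "y \<in> pverts G" using xy by (auto dest: in_arcsD1 in_arcsD2)
  have yx: "(y, x) \<in> parcs G" using xy adj_sym by blast
  let ?d = "\<lambda>v. real (graph_dist G y v)"
  have ne: "card (nbrs x) > 0" "card (nbrs y) > 0"
    using xy yx by (auto simp: card_gt_0_iff)
  have dist_nbrs: "(\<Sum>v\<in>nbrs y. ?d v) = (\<Sum>v\<in>nbrs y. 1)"
    using V nbrs_subset by (intro sum.cong) (auto simp: graph_dist_eq subset_iff)
  have avg: "(\<Sum>v\<in>nbrs x. ?d v) \<le> real (card (nbrs x))"
  proof -
    have "x \<noteq> y" using xy by auto
    then have "graph_dist G y x = graph_dist G y y + 1" using V yx by (simp add: graph_dist_eq)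
    from avg_graph_dist_le[OF xy V(2) this] dist_nbrs ne yx show ?thesis by (auto simp: divide_le_eq split: if_splits)
  qed
  let ?W = "{y, w1, w2}"
  have W: "?W \<subseteq> nbrs x" using xy w by auto
  have card: "card ?W = 3" using w \<open>w1 \<noteq> w2\<close> by auto
  have "(\<Sum>v\<in>nbrs x. ?d v) = (\<Sum>v\<in>?W. ?d v) + (\<Sum>v\<in>nbrs x - ?W. ?d v)"
    using sum.subset_diff[OF W finite_nbrs] by (simp only: add.commute)
  also have "(\<Sum>v\<in>?W. ?d v) = 4"
    using w \<open>w1 \<noteq> w2\<close> V nbrs_subset by (auto simp: graph_dist_eq subset_iff)
  finally have "(\<Sum>v\<in>nbrs x. ?d v) = 4 + (\<Sum>v\<in>nbrs x - ?W. ?d v)" .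
  \<comment> \<open>Removing \<open>?W\<close> removes \<open>y\<close>, so all remaining distances
    are at least 1. The total then exceeds the degree of \<open>x\<close> by at least 1.\<close>
  moreover have "(\<Sum>v\<in>nbrs x - ?W. 1) \<le> (\<Sum>v\<in>nbrs x - ?W. ?d v)"
    using V nbrs_subset by (intro sum_mono) (auto simp: graph_dist_eq subset_iff)
  ultimately have "(\<Sum>v\<in>nbrs x. ?d v) \<ge> 4 + real (card (nbrs x - ?W))" by simp
  moreover have "card (nbrs x - ?W) + 3 = card (nbrs x)"
    using card_Diff_subset[of ?W "nbrs x"] card_mono[OF _ W] W card by simp
  ultimately show False using avg by simp
qed

text \<open>Both neighbourhoods are the common part \<open>C\<close> plus two vertices, so the means
  have equal denominators and \<open>C\<close> cancels. If \<open>w\<close> and \<open>z\<close>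
  were not adjacent, the rest would be 1 + 2 from \<open>y\<close>, \<open>w\<close> against 2 + 0
  from \<open>x\<close>, \<open>z\<close>.\<close>

lemma nonnbrs_along_edge_adj:
  assumes xy: "(x, y) \<in> parcs G"
    and w: "w \<in> nbrs x - nbrs y - {y}" and z: "z \<in> nbrs y - nbrs x - {x}"
  shows "(w, z) \<in> parcs G"
proof (rule ccontr)
  assume wz: "(w, z) \<notin> parcs G"
  have yx: "(y, x) \<in> parcs G" using xy adj_sym by blast
  have V: "x \<in> pverts G" "y \<in> pverts G" "w \<in> pverts G" "z \<in> pverts G"
    using xy w z by (auto dest: in_arcsD1 in_arcsD2)
  let ?d = "\<lambda>v. real (graph_dist G z v)"
  define C where "C = nbrs x \<inter> nbrs y"
  have C: "finite C" "x \<notin> C" "y \<notin> C" "w \<notin> C" "z \<notin> C"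
    using w z by (auto simp: C_def)
  \<comment> \<open>By uniqueness, \<open>w\<close> is the only neighbour of \<open>x\<close>
    outside the closed neighbourhood of \<open>y\<close>.\<close>
  have Nx: "nbrs x = insert y (insert w C)"
  proof -
    have "nbrs x - nbrs y - {y} = {w}" using nonnbrs_along_edge_unique[OF xy _ w] w by blast
    then show ?thesis using xy unfolding C_def by blast
  qed
  have Ny: "nbrs y = insert x (insert z C)"
  proof -
    have "nbrs y - nbrs x - {x} = {z}" using nonnbrs_along_edge_unique[OF yx _ z] z by blast
    then show ?thesis using yx unfolding C_def by blast
  qed
  have "w \<noteq> y" "z \<noteq> x" "w \<noteq> z" using w z by auto
  have nadj: "(z, x) \<notin> parcs G" "(z, w) \<notin> parcs G" "(z, y) \<in> parcs G"
    using w z wz adj_sym by auto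
  have d: "graph_dist G z x = 2" "graph_dist G z y = 1" "graph_dist G z w = 2" "graph_dist G z z = 0"
    using V nadj \<open>z \<noteq> x\<close> \<open>w \<noteq> z\<close> z by (auto simp: graph_dist_eq)
  have "(\<Sum>v\<in>nbrs x. ?d v) = 3 + (\<Sum>v\<in>C. ?d v)" "(\<Sum>v\<in>nbrs y. ?d v) = 2 + (\<Sum>v\<in>C. ?d v)"
    unfolding Nx Ny using C \<open>w \<noteq> y\<close> \<open>z \<noteq> x\<close> d by simp_all
  moreover have "card (nbrs x) = card C + 2" "card (nbrs y) = card C + 2"
    unfolding Nx Ny using C \<open>w \<noteq> y\<close> \<open>z \<noteq> x\<close> by simp_all
  ultimately show False
    using avg_graph_dist_le[OF xy V(4)] d by (simp add: divide_le_cancel)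
qed

text \<open>Two non-neighbours \<open>z\<close>, \<open>w\<close> of \<open>x\<close> are reached
  through common neighbours \<open>y\<close>, \<open>y'\<close>. Uniqueness along the edges to
  \<open>x\<close> separates \<open>y\<close> from \<open>w\<close> and \<open>y'\<close> from
  \<open>z\<close>; then both adjacency and non-adjacency of \<open>y\<close> and \<open>y'\<close>
  are impossible.\<close>

lemma nonnbr_unique:
  assumes V: "x \<in> pverts G" "z \<in> pverts G" "w \<in> pverts G"
    and z: "z \<noteq> x" "(x, z) \<notin> parcs G" and w: "w \<noteq> x" "(x, w) \<notin> parcs G"
  shows "z = w"
proof (rule ccontr)
  assume "z \<noteq> w"
  obtain y where y: "(x, y) \<in> parcs G" "(y, z) \<in> parcs G" using common_nbr V z by metis
  obtain y' where y': "(x, y') \<in> parcs G" "(y', w) \<in> parcs G" using common_nbr V w by metis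
  have yw: "(y, w) \<notin> parcs G"
    using nonnbrs_along_edge_unique[of y x z w] y z w \<open>z \<noteq> w\<close> adj_sym by auto
  have y'z: "(y', z) \<notin> parcs G"
    using nonnbrs_along_edge_unique[of y' x z w] y' z w \<open>z \<noteq> w\<close> adj_sym by auto
  have "y \<noteq> y'" using yw y' by auto
  show False
  proof (cases "(y, y') \<in> parcs G")
    case True
    \<comment> \<open>Along the edge from \<open>y\<close> to \<open>z\<close>, both
      \<open>x\<close> and \<open>y'\<close> are neighbours of \<open>y\<close> but not of
      \<open>z\<close>.\<close>
    then have "x = y'"
      using nonnbrs_along_edge_unique[of y z x y'] y z y'z y' w adj_sym by auto
    then show False using y' by simp
  next
    case False
    \<comment> \<open>Along the edge from \<open>x\<close> to \<open>y\<close>, the private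
      neighbours are \<open>y'\<close> on the side of \<open>x\<close> and \<open>z\<close> on the
      side of \<open>y\<close>.\<close>
    then have "(y', z) \<in> parcs G"
      using nonnbrs_along_edge_adj[of x y y' z] y z y' \<open>y \<noteq> y'\<close> adj_sym by auto
    then show False using y'z by simp
  qed
qed

section \<open>Isomorphism with the matching complement\<close>

text \<open>The non-edges \<open>P\<close> are pairwise disjoint pairs. Numbering them, choosing an
  order inside each, and numbering the uncovered vertices separately gives the bijection
  \<open>h\<close> from the vertices of the model.\<close>

lemma iso_matching_complement_graph:
  "\<exists>a b :: nat. a > 0 \<and> digraph_iso (with_proj G) (with_proj (matching_complement_graph a b))"
proof -
  let ?V = "pverts G"
  define P where "P = {{x, y} | x y. x \<in> ?V \<and> y \<in> ?V \<and> x \<noteq> y \<and> (x, y) \<notin> parcs G}"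
  define a where "a = card P"
  define b where "b = card (?V - \<Union>P)"
  have PV: "\<Union>P \<subseteq> ?V" by (auto simp: P_def)
  have "P \<subseteq> Pow ?V" by (auto simp: P_def)
  then have finP: "finite P" using pair_finite_verts by (meson finite_Pow_iff finite_subset)
  have P_iff: "{x, y} \<in> P \<longleftrightarrow> x \<noteq> y \<and> (x, y) \<notin> parcs G" if "x \<in> ?V" "y \<in> ?V" for x y
    using that adj_sym by (auto simp: P_def doubleton_eq_iff)
  \<comment> \<open>Each non-edge through \<open>v\<close> consists of \<open>v\<close> and a
    non-neighbour of \<open>v\<close>, and there is only one of those.\<close>
  have disj: "A = B" if AB: "A \<in> P" "B \<in> P" and v: "v \<in> A" "v \<in> B" for A B v
  proof -
    have "\<exists>w. C = {v, w} \<and> v \<in> ?V \<and> w \<in> ?V \<and> w \<noteq> v \<and> (v, w) \<notin> parcs G"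
      if C: "C \<in> P" "v \<in> C" for C
    proof -
      from C obtain x y where "C = {x, y}" "x \<in> ?V" "y \<in> ?V" "x \<noteq> y" "(x, y) \<notin> parcs G"
        by (auto simp: P_def)
      then show ?thesis using C(2) adj_sym by (cases "v = x") auto
    qed
    from this[OF AB(1) v(1)] this[OF AB(2) v(2)] show ?thesis using nonnbr_unique by metis
  qed

  \<comment> \<open>A pair realising the diameter is a non-edge, which makes \<open>a\<close>
    positive.\<close>
  obtain x y where xy: "x \<in> ?V" "y \<in> ?V" "graph_dist G x y = 2"
  proof -
    have "?V \<noteq> {}" using conn by (auto simp: connected_def strongly_connected_def)
    then show thesis using graph_diam_attained diam that by metis
  qed
  have "{x, y} \<in> P" using xy P_iff by (auto simp: graph_dist_eq split: if_splits)
  then have "a > 0" using finP by (auto simp: a_def card_gt_0_iff)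

  obtain k where k: "bij_betw k {1..a} P"
    using ex_bij_betw_nat_finite_1[OF finP] unfolding a_def by blast
  obtain e where e: "bij_betw e {1..b} (?V - \<Union>P)"
    using ex_bij_betw_nat_finite_1[of "?V - \<Union>P"] pair_finite_verts unfolding b_def by blast
  have kP: "k i \<in> P" if "i \<in> {1..a}" for i using k that by (auto simp: bij_betw_def)
  have "\<forall>i\<in>{1..a}. \<exists>p. k i = {fst p, snd p} \<and> fst p \<noteq> snd p"
  proof
    fix i assume "i \<in> {1..a}"
    then have "k i \<in> P" by (rule kP)
    then obtain x y where "k i = {x, y}" "x \<noteq> y" unfolding P_def by blast
    then show "\<exists>p. k i = {fst p, snd p} \<and> fst p \<noteq> snd p" by (intro exI[of _ "(x, y)"]) simp
  qed
  from bchoice[OF this] obtain p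
    where p: "\<forall>i\<in>{1..a}. k i = {fst (p i), snd (p i)} \<and> fst (p i) \<noteq> snd (p i)" ..

  define h :: "nat + nat \<Rightarrow> 'a" where
    "h = case_sum (\<lambda>n. if odd n then fst (p ((n + 1) div 2)) else snd (p (n div 2))) e"
  let ?H = "matching_complement_graph a b"
  let ?VH = "matching_complement_verts a b"
  have VH: "pverts ?H = ?VH" by (simp add: matching_complement_graph_def)
  have k_eq: "k i = {h (Inl (2 * i - 1)), h (Inl (2 * i))}"
    and h_neq: "h (Inl (2 * i - 1)) \<noteq> h (Inl (2 * i))" if "i \<in> {1..a}" for i
  proof -
    \<comment> \<open>Subtraction on \<open>nat\<close> is truncated: both facts rely on
      \<open>i\<close> being at least 1.\<close>
    have "odd (2 * i - 1)" "(2 * i - 1 + 1) div 2 = i" using that by auto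
    then have "h (Inl (2 * i - 1)) = fst (p i)" "h (Inl (2 * i)) = snd (p i)"
      by (simp_all add: h_def)
    with bspec[OF p that] show "k i = {h (Inl (2 * i - 1)), h (Inl (2 * i))}"
      and "h (Inl (2 * i - 1)) \<noteq> h (Inl (2 * i))" by metis+
  qed
  have h_r: "h (Inr j) = e j" for j by (simp add: h_def)
  have split: "\<exists>i\<in>{1..a}. n = 2 * i - 1 \<or> n = 2 * i" if "n \<in> {1..2 * a}" for n
  proof (cases "even n")
    case True
    then show ?thesis using that by (intro bexI[of _ "n div 2"]) auto
  next
    case False
    then obtain m where "n = 2 * m + 1" by (elim oddE)
    then show ?thesis using that by (intro bexI[of _ "m + 1"]) auto
  qed
  have img_l: "h ` Inl ` {1..2 * a} = \<Union>P"
  proof (intro equalityI subsetI)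
    fix v assume "v \<in> h ` Inl ` {1..2 * a}"
    then obtain n where n: "n \<in> {1..2 * a}" "v = h (Inl n)" by blast
    then obtain i where i: "i \<in> {1..a}" "n = 2 * i - 1 \<or> n = 2 * i" using split by blast
    then have "v \<in> k i" unfolding k_eq[OF i(1)] using n(2) by blast
    then show "v \<in> \<Union>P" using kP[OF i(1)] by blast
  next
    fix v assume "v \<in> \<Union>P"
    then obtain i where i: "i \<in> {1..a}" "v \<in> k i" using k by (auto simp: bij_betw_def)
    then have "v = h (Inl (2 * i - 1)) \<or> v = h (Inl (2 * i))" using k_eq[OF i(1)] by blast
    moreover have "2 * i - 1 \<in> {1..2 * a}" "2 * i \<in> {1..2 * a}" using i(1) by auto
    ultimately show "v \<in> h ` Inl ` {1..2 * a}" by blast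
  qed
  have img_r: "h ` Inr ` {1..b} = ?V - \<Union>P"
    using e by (simp add: image_image h_r bij_betw_def)
  have inj_l: "inj_on h (Inl ` {1..2 * a})"
  proof (rule inj_onI)
    fix s t assume "s \<in> Inl ` {1..2 * a}" "t \<in> Inl ` {1..2 * a}" and eq: "h s = h t"
    then obtain n m where nm: "s = Inl n" "t = Inl m" "n \<in> {1..2 * a}" "m \<in> {1..2 * a}" by blast
    obtain i where i: "i \<in> {1..a}" "n = 2 * i - 1 \<or> n = 2 * i" using split nm by blast
    obtain j where j: "j \<in> {1..a}" "m = 2 * j - 1 \<or> m = 2 * j" using split nm by blast
    have "h s \<in> k i" unfolding k_eq[OF i(1)] nm(1) using i(2) by blast
    moreover have "h s \<in> k j" unfolding k_eq[OF j(1)] eq nm(2) using j(2) by blast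
    ultimately have "k i = k j" using disj kP i(1) j(1) by blast
    then have "i = j" using k i(1) j(1) by (auto simp: bij_betw_def dest: inj_onD)
    then show "s = t" using nm(1,2) eq i(2) j(2) h_neq[OF i(1)] by metis
  qed
  have inj_r: "inj_on h (Inr ` {1..b})"
    by (rule inj_on_imageI) (use e in \<open>simp add: comp_def h_r bij_betw_def\<close>)
  have "bij_betw h (Inl ` {1..2 * a} \<union> Inr ` {1..b}) (\<Union>P \<union> (?V - \<Union>P))"
    by (rule bij_betw_combine) (use inj_l inj_r img_l img_r in \<open>auto simp: bij_betw_def\<close>)
  then have bij: "bij_betw h ?VH ?V"
    using PV by (simp add: matching_complement_verts_def Un_absorb1)
  then have inj: "inj_on h ?VH" and hV: "\<And>s. s \<in> ?VH \<Longrightarrow> h s \<in> ?V"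
    by (auto simp: bij_betw_def)
  have matched: "(\<exists>i\<in>{1..a}. {s, t} = {Inl (2 * i - 1), Inl (2 * i)}) \<longleftrightarrow> {h s, h t} \<in> P"
    if st: "s \<in> ?VH" "t \<in> ?VH" for s t
  proof -
    \<comment> \<open>Comparing images of whole sets under the injective \<open>h\<close> avoids a
      case split on the order inside the pair.\<close>
    have eq_iff: "{s, t} = {Inl (2 * i - 1), Inl (2 * i)} \<longleftrightarrow> {h s, h t} = k i" if i: "i \<in> {1..a}" for i
    proof -
      have "2 * i - 1 \<in> {1..2 * a}" "2 * i \<in> {1..2 * a}" using i by auto
      then have E: "{Inl (2 * i - 1), Inl (2 * i)} \<subseteq> ?VH"
        unfolding matching_complement_verts_def by blast
      have "{s, t} \<subseteq> ?VH" using st by blast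
      from inj_on_image_eq_iff[OF inj this E] show ?thesis
        by (simp only: k_eq[OF i] image_insert image_empty)
    qed
    have "P = k ` {1..a}" using k by (simp add: bij_betw_def)
    then show ?thesis unfolding image_iff using eq_iff by blast
  qed
  have "digraph_iso (with_proj G) (with_proj ?H)"
  proof (rule digraph_iso_with_projI)
    show "pair_wf_digraph G" by unfold_locales
    show "pair_wf_digraph ?H"
      using pair_graph_matching_complement_graph by (simp add: pair_graph_def pair_digraph_def pair_fin_digraph_def)
    show "bij_betw h (pverts ?H) ?V" using bij VH by simp
  next
    fix s t assume "s \<in> pverts ?H" "t \<in> pverts ?H"
    then have st: "s \<in> ?VH" "t \<in> ?VH" using VH by auto
    have "(h s, h t) \<in> parcs G \<longleftrightarrow> h s \<noteq> h t \<and> {h s, h t} \<notin> P"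
      using P_iff[of "h s" "h t"] hV st by (metis not_adj_self)
    also have "\<dots> \<longleftrightarrow> s \<noteq> t \<and> {h s, h t} \<notin> P" using inj st by (auto dest: inj_onD)
    also have "\<dots> \<longleftrightarrow> (s, t) \<in> parcs ?H"
      using st by (simp add: matching_complement_graph_def flip: matched[OF st])
    finally show "(h s, h t) \<in> parcs G \<longleftrightarrow> (s, t) \<in> parcs ?H" .
  qed
  then show ?thesis using \<open>a > 0\<close> by blast
qed

end

theorem theorem3p7:
  fixes G :: "'a pair_pre_digraph"
  assumes "pair_graph G"
    and "Digraph_Component.connected (with_proj G)"
    and "bonnet_myers_sharp G"
    and "graph_diam G = 2"
  shows "\<exists>a b :: nat. a > 0 \<and> digraph_iso (with_proj G) (with_proj (matching_complement_graph a b))"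
proof -
  interpret diam2_sharp_graph G
    using assms by (simp add: diam2_sharp_graph_def diam2_sharp_graph_axioms_def)
  show ?thesis by (rule iso_matching_complement_graph)
qed

end
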